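(* For every real number $p>2$, there are infinitely many connected simple graphs $G$ for which there exists a nonedge $uv$ of $G$ (that is, two distinct vertices $u,v$ of $G$ with $uv\notin E(G)$) such that \[ \mathcal E_p^+(G+uv)<\mathcal E_p^+(G). \]
   Context: Graphs are finite and simple; "infinitely many graphs" is understood up to isomorphism. For a graph $G$ with adjacency eigenvalues $\lambda_i(G)$ (the eigenvalues of its adjacency matrix, counted with multiplicity) and a real number $p\ge 1$, the positive $p$-energy is \[ \mathcal E_p^+(G)=\sum_{\lambda_i(G)>0}\lambda_i(G)^p . \] For a nonedge $uv$ of $G$, $G+uv$ denotes the graph obtained from $G$ by adding the edge $uv$. *)

theory Defs
  imports
    Complex_Main
    "Graph_Theory.Graph_Theory"
    "Jordan_Normal_Form.Spectral_Radius"
begin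

text \<open>
  A finite simple graph is a \<^locale>\<open>pair_graph\<close>: a finite vertex set together with an
  irreflexive symmetric set of arcs, the edge \<open>uv\<close> being represented by the two arcs
  \<open>(u, v)\<close> and \<open>(v, u)\<close>.
\<close>

definition add_edge :: "'a pair_pre_digraph \<Rightarrow> 'a \<Rightarrow> 'a \<Rightarrow> 'a pair_pre_digraph" where
  "add_edge G u v = \<lparr> pverts = pverts G, parcs = parcs G \<union> {(u, v), (v, u)} \<rparr>"

text \<open>
  The rows and columns are indexed by the vertices in increasing order. Another enumeration of
  the vertices conjugates the matrix by a permutation and so does not change the eigenvalues.
\<close>

definition adj_matrix :: "'a::linorder pair_pre_digraph \<Rightarrow> real mat" where
  "adj_matrix G =
    (let vs = sorted_list_of_set (pverts G); n = card (pverts G)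
     in mat n n (\<lambda>(i, j). if (vs ! i, vs ! j) \<in> parcs G then 1 else 0))"

text \<open>
  The multiset of eigenvalues, with their multiplicities as roots of the characteristic polynomial.
  The matrix is real symmetric, so this is all of its spectrum, and the multiplicities
  agree with the geometric ones.
\<close>

definition adj_eigenvalues :: "'a::linorder pair_pre_digraph \<Rightarrow> real multiset" where
  "adj_eigenvalues G = proots (char_poly (adj_matrix G))"

definition positive_energy :: "real \<Rightarrow> 'a::linorder pair_pre_digraph \<Rightarrow> real" where
  "positive_energy p G =
    (\<Sum>l\<in>#filter_mset (\<lambda>l. 0 < l) (adj_eigenvalues G). l powr p)"

lemma adj_matrix_carrier: "adj_matrix G \<in> carrier_mat (card (pverts G)) (card (pverts G))"
  by (simp add: adj_matrix_def Let_def)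

lemma set_adj_eigenvalues: "set_mset (adj_eigenvalues G) = {l. eigenvalue (adj_matrix G) l}"
proof -
  have "char_poly (adj_matrix G) \<noteq> 0"
    using degree_monic_char_poly[OF adj_matrix_carrier[of G]] by auto
  then show ?thesis
    by (simp add: adj_eigenvalues_def eigenvalue_root_char_poly[OF adj_matrix_carrier])
qed

lemma (in pair_graph) pair_graph_add_edge:
  assumes "u \<in> pverts G" "v \<in> pverts G" "u \<noteq> v"
  shows "pair_graph (add_edge G u v)"
proof
  show "symmetric (with_proj (add_edge G u v))"
    using pair_sym_arcs by (auto simp: symmetric_def add_edge_def sym_def)
qed (use assms pair_no_loops in \<open>auto simp: add_edge_def dest: wellformed'\<close>)

end

theory Submission
  imports Defs "HOL-Real_Asymp.Real_Asymp"
begin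

text \<open>
  If \<open>G \<subseteq> G'\<close> are graphs on the same vertices, \<open>G\<close> is connected and \<open>G'\<close> has the smaller energy, then
  on any path from \<open>G\<close> to \<open>G'\<close> that adds one edge at a time some single edge decreases the energy. So
  it suffices to find two such graphs with explicit spectra, and Cayley graphs of elementary abelian
  2-groups, which are diagonalised by the Walsh functions, provide them.

  \<open>G\<close> is the Hamming graph \<open>H(D, m)\<close> with \<open>m = 2\<^sup>a\<close>, every vertex blown up into \<open>M = 2\<^sup>n\<close> independent
  copies, and \<open>G'\<close> adds the perfect matching given by a translation \<open>t\<close> that moves all \<open>D\<close> coordinates.
  The nonzero eigenvalues \<open>M \<lambda>\<close> of \<open>G\<close> become \<open>M \<lambda> \<plusminus> 1\<close> and the others become \<open>\<plusminus>1\<close>, so the energy changes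
  by \<open>p K M\<^sup>p\<^sup>-\<^sup>1 + o(M\<^sup>p\<^sup>-\<^sup>1) + O(M)\<close>, where \<open>K\<close> is the \<open>D\<close>-th finite difference at \<open>0\<close> of
  \<open>x \<mapsto> (max 0 (m x - D))\<^sup>q\<close> with \<open>q = p - 1 > 1\<close>. Take \<open>D = \<lfloor>q\<rfloor> + 2\<close>. If \<open>q\<close> is an integer, the function
  is a polynomial of degree less than \<open>D\<close> except at the node \<open>0\<close>, and \<open>K = - D\<^sup>q\<close> for \<open>m \<ge> D\<close>. Otherwise
  \<open>K m\<^sup>-\<^sup>q\<close> tends, as \<open>m \<rightarrow> \<infinity>\<close>, to the \<open>D\<close>-th difference of \<open>x\<^sup>q\<close> at \<open>0\<close>, which is negative.
\<close>

section \<open>Finite differences of powers\<close>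

text \<open>Truncation replaces the restriction to positive eigenvalues: the energy becomes a sum of
  one function over the whole spectrum.\<close>

definition pos_powr :: "real \<Rightarrow> real \<Rightarrow> real" where
  "pos_powr p x = max 0 x powr p"

lemma pos_powr_of_pos: "0 < x \<Longrightarrow> pos_powr p x = x powr p"
  by (simp add: pos_powr_def)

lemma pos_powr_of_nonpos [simp]: "x \<le> 0 \<Longrightarrow> pos_powr p x = 0"
  by (simp add: pos_powr_def)

lemma pos_powr_mult:
  assumes "0 < c" shows "pos_powr p (c * x) = c powr p * pos_powr p x"
proof (cases "0 < x")
  case True
  with assms show ?thesis by (simp add: pos_powr_of_pos powr_mult)
next
  case False
  with assms show ?thesis by (simp add: mult_nonneg_nonpos)
qed

lemma isCont_pos_powr:
  assumes "0 < p" shows "isCont (pos_powr p) x"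
  unfolding pos_powr_def [abs_def] isCont_def using assms
  by (intro tendsto_powr' tendsto_intros) auto

lemma DERIV_pos_powr_of_pos:
  assumes "0 < x" shows "(pos_powr p has_real_derivative p * pos_powr (p - 1) x) (at x)"
proof -
  have "((\<lambda>y. y powr p) has_real_derivative p * x powr (p - 1)) (at x)"
    using assms by (auto intro!: derivative_eq_intros)
  then have "(pos_powr p has_real_derivative p * x powr (p - 1)) (at x)"
    by (rule DERIV_cong_ev [OF refl _ refl, THEN iffD1, rotated])
      (use assms eventually_nhds_in_open [of "{0<..}" x] in
        \<open>auto elim!: eventually_mono simp: pos_powr_of_pos\<close>)
  with assms show ?thesis by (simp add: pos_powr_of_pos)
qed

lemma DERIV_pos_powr:
  assumes "1 < p" shows "(pos_powr p has_real_derivative p * pos_powr (p - 1) x) (at x)"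
proof (cases x "0 :: real" rule: linorder_cases)
  case less
  have "((\<lambda>_. 0) has_real_derivative 0) (at x)" by simp
  then have "(pos_powr p has_real_derivative 0) (at x)"
    by (rule DERIV_cong_ev [OF refl _ refl, THEN iffD1, rotated])
      (use less eventually_nhds_in_open [of "{..<0}" x] in \<open>auto elim!: eventually_mono\<close>)
  with less show ?thesis by simp
next
  case equal
  have "((\<lambda>h. pos_powr (p - 1) h) \<longlongrightarrow> 0) (at 0)"
    using isCont_pos_powr [of "p - 1" 0] assms by (simp add: isCont_def)
  \<comment> \<open>At 0 the difference quotient with step \<open>h\<close> is
    \<open>pos_powr (p - 1) h\<close> itself, which tends to 0 because
    \<open>p - 1 > 0\<close>.\<close>
  moreover have "pos_powr (p - 1) h = (pos_powr p (0 + h) - pos_powr p 0) / h" for h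
    by (cases "0 < h") (auto simp: pos_powr_of_pos powr_diff)
  ultimately show ?thesis using equal by (simp add: DERIV_def)
next
  case greater
  then show ?thesis by (rule DERIV_pos_powr_of_pos)
qed

section \<open>Iterated forward differences\<close>

definition fdiff :: "(real \<Rightarrow> real) \<Rightarrow> real \<Rightarrow> real" where
  "fdiff f x = f (x + 1) - f x"

lemma fdiff_pow_Suc: "(fdiff ^^ Suc n) f x = (fdiff ^^ n) f (x + 1) - (fdiff ^^ n) f x"
  by (simp add: fdiff_def)

lemma fdiff_pow_add:
  "(fdiff ^^ n) (\<lambda>x. f x + g x) x = (fdiff ^^ n) f x + (fdiff ^^ n) g x"
  by (induction n arbitrary: x) (auto simp: fdiff_def)

lemma fdiff_pow_cmult:
  "(fdiff ^^ n) (\<lambda>x. c * f x) x = c * (fdiff ^^ n) f x"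
  by (induction n arbitrary: x) (auto simp: fdiff_def algebra_simps)

lemma fdiff_pow_tendsto:
  assumes "\<And>x. ((\<lambda>i. f i x) \<longlongrightarrow> g x) F"
  shows "((\<lambda>i. (fdiff ^^ n) (f i) x) \<longlongrightarrow> (fdiff ^^ n) g x) F"
proof (induction n arbitrary: x)
  case (Suc n) then show ?case unfolding fdiff_pow_Suc by (intro tendsto_intros)
qed (use assms in simp)

text \<open>Forward differences look only to the right, so a ray is the natural domain; it covers
  exponents for which \<open>pos_powr\<close> is not differentiable at 0.\<close>

lemma fdiff_pow_DERIV:
  assumes "\<And>x. a < x \<Longrightarrow> (f has_real_derivative f' x) (at x)" and "a < x"
  shows "((fdiff ^^ n) f has_real_derivative (fdiff ^^ n) f' x) (at x)"
  using assms(2)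
proof (induction n arbitrary: x)
  case (Suc n)
  have "((\<lambda>x. (fdiff ^^ n) f (x + 1)) has_real_derivative (fdiff ^^ n) f' (x + 1)) (at x)"
    using Suc.IH [of "x + 1"] Suc.prems DERIV_shift by auto
  then show ?case
    unfolding fdiff_pow_Suc fun_eq_iff [of "(fdiff ^^ Suc n) f"]
    using DERIV_diff [OF _ Suc.IH [OF Suc.prems]] by (simp add: fdiff_def [abs_def])
qed (use assms in simp)

lemma fdiff_pow_isCont:
  assumes "\<And>x. isCont f x" shows "isCont ((fdiff ^^ n) f) x"
proof (induction n arbitrary: x)
  case (Suc n)
  have "isCont (\<lambda>x. (fdiff ^^ n) f (x + 1)) x"
    by (rule isCont_o2 [OF _ Suc]) (intro continuous_intros)
  then show ?case using Suc by (simp add: fdiff_def [abs_def])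
qed (use assms in simp)

text \<open>The difference of order \<open>Suc n\<close> compares \<open>fdiff ^^ n\<close> at
  \<open>x + 1\<close> and at \<open>x\<close>, and by \<open>neg\<close> that function has negative
  derivative in between. Only the open interval is differentiated, so continuity suffices at
  \<open>x = 0\<close>.\<close>

lemma fdiff_pow_pos_powr_neg_Suc:
  assumes e: "0 < e" and x: "0 \<le> x"
    and neg: "\<And>y. 0 < y \<Longrightarrow> (fdiff ^^ n) (pos_powr (e - 1)) y < 0"
  shows "(fdiff ^^ Suc n) (pos_powr e) x < 0"
proof -
  have deriv: "((fdiff ^^ n) (pos_powr e) has_real_derivative
      (fdiff ^^ n) (\<lambda>y. e * pos_powr (e - 1) y) y) (at y)" if "0 < y" for y
    using that by (intro fdiff_pow_DERIV [of 0] DERIV_pos_powr_of_pos)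
  have "(fdiff ^^ n) (pos_powr e) (x + 1) < (fdiff ^^ n) (pos_powr e) x"
  proof (rule DERIV_neg_imp_decreasing_open [of x "x + 1"])
    show "x < x + 1" by simp
  next
    fix y assume "x < y" "y < x + 1"
    with x have "0 < y" by simp
    with deriv [of y] neg [of y] e
    show "\<exists>d. ((fdiff ^^ n) (pos_powr e) has_real_derivative d) (at y) \<and> d < 0"
      by (auto simp: fdiff_pow_cmult mult_less_0_iff)
  next
    show "continuous_on {x..x + 1} ((fdiff ^^ n) (pos_powr e))"
      using fdiff_pow_isCont [OF isCont_pos_powr [OF e]] continuous_at_imp_continuous_on by blast
  qed
  then show ?thesis by (simp add: fdiff_def)
qed

text \<open>The start is that \<open>y powr (r - 1)\<close> decreases; each use of the preceding
  lemma then raises both the exponent and the order of the difference by 1.\<close>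

lemma fdiff_pow_pos_powr_neg:
  assumes r: "0 < r" "r < 1" and "0 \<le> x"
  shows "(fdiff ^^ (k + 2)) (pos_powr (real k + r)) x < 0"
proof -
  \<comment> \<open>The induction stays at \<open>y > 0\<close>, since the initial exponent
    \<open>r - 1\<close> is negative; one last application reaches 0.\<close>
  have "(fdiff ^^ Suc k) (pos_powr (real k + r - 1)) y < 0" if "0 < y" for y
    using that
  proof (induction k arbitrary: y)
    case 0
    then have "(y + 1) powr (r - 1) < y powr (r - 1)"
      using r by (intro powr_less_mono2_neg) auto
    with 0 show ?case by (simp add: fdiff_def pos_powr_of_pos)
  next
    case (Suc k)
    then show ?case
      using fdiff_pow_pos_powr_neg_Suc [of "real k + r" y "Suc k"] r by (simp add: algebra_simps)
  qed
  then show ?thesis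
    using fdiff_pow_pos_powr_neg_Suc [of "real k + r" x "Suc k"] assms by simp
qed

text \<open>By the induction hypothesis the difference of order \<open>Suc k\<close> of a power of
  degree \<open>Suc k\<close> has derivative 0. It is therefore constant, and one further difference
  annihilates it.\<close>

lemma fdiff_pow_power_eq_0: "(fdiff ^^ Suc k) (\<lambda>x. (m * x + c) ^ k) x = 0"
proof (induction k arbitrary: x)
  case (Suc k)
  have "((fdiff ^^ Suc k) (\<lambda>x. (m * x + c) ^ Suc k) has_real_derivative 0) (at y)" for y
  proof -
    have "((\<lambda>x. (m * x + c) ^ Suc k) has_real_derivative (Suc k * m) * (m * z + c) ^ k) (at z)" for z
    proof -
      have "((\<lambda>x. m * x + c) has_real_derivative m) (at z)"
        by (auto intro!: derivative_eq_intros)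
      from DERIV_power [OF this, of "Suc k"] show ?thesis by (simp del: power_Suc add: ac_simps)
    qed
    then have "((fdiff ^^ Suc k) (\<lambda>x. (m * x + c) ^ Suc k) has_real_derivative
        (fdiff ^^ Suc k) (\<lambda>z. (Suc k * m) * (m * z + c) ^ k) y) (at y)"
      by (intro fdiff_pow_DERIV [of "y - 1"]) auto
    then show ?thesis using Suc by (simp only: fdiff_pow_cmult mult_zero_right)
  qed
  then have "(fdiff ^^ Suc k) (\<lambda>x. (m * x + c) ^ Suc k) (x + 1)
      = (fdiff ^^ Suc k) (\<lambda>x. (m * x + c) ^ Suc k) x"
    by (rule DERIV_isconst_all [rule_format])
  then show ?case by (subst fdiff_pow_Suc) simp
qed (simp add: fdiff_def)

text \<open>Among the nodes \<open>0, ..., n\<close> only 0 contributes, with coefficient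
  \<open>(- 1) ^ n\<close>. The induction also carries the vanishing at positive integers.\<close>

lemma fdiff_pow_supported_at_0:
  assumes "\<And>j. 0 < j \<Longrightarrow> f (real j) = 0"
  shows "(fdiff ^^ n) f 0 = (- 1) ^ n * f 0"
proof -
  have "(fdiff ^^ n) f 0 = (- 1) ^ n * f 0 \<and> (\<forall>j>0. (fdiff ^^ n) f (real j) = 0)"
  proof (induction n)
    case (Suc n)
    have "(fdiff ^^ n) f (real j + 1) = 0" for j
      using Suc [THEN conjunct2, rule_format, of "Suc j"] by (simp add: add.commute)
    from this this [of 0] show ?case
      unfolding fdiff_pow_Suc using Suc by simp
  qed (use assms in simp)
  then show ?thesis ..
qed

lemma ex_fdiff_pos_powr_neg:
  assumes q: "1 < q"
  shows "\<exists>D a. 2 \<le> D \<and> 0 < a \<and> (fdiff ^^ D) (\<lambda>x. pos_powr q (2 ^ a * x - real D)) 0 < 0"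
proof -
  define k where "k = nat \<lfloor>q\<rfloor>"
  define r where "r = q - real k"
  define D where "D = k + 2"
  have r: "0 \<le> r" "r < 1" using q unfolding r_def k_def by linarith+
  have k: "0 < k" using q unfolding k_def by linarith
  show ?thesis
  proof (cases "r = 0")
    case True
    then have q: "q = real k" by (simp add: r_def)
    \<comment> \<open>The choice \<open>a = D\<close> makes the argument nonnegative at every node
      \<open>j > 0\<close>. There the truncated power agrees with the polynomial, so their
      difference \<open>f\<close> survives only at 0.\<close>
    have m: "real D \<le> 2 ^ D" using of_nat_less_two_power [of D, where ?'a = real] by simp
    define f where "f x = pos_powr q (2 ^ D * x - real D) + (- 1) * (2 ^ D * x + (- real D)) ^ k" for x
    have "f (real j) = 0" if "0 < j" for j
    proof -
      have "real D \<le> 2 ^ D * 1" using m by simp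
      also have "\<dots> \<le> 2 ^ D * real j" using that by (intro mult_left_mono) auto
      \<comment> \<open>When the argument is 0, both terms vanish because
        \<open>0 < k\<close>.\<close>
      finally show ?thesis using k
        by (cases "real D = 2 ^ D * real j") (auto simp: f_def q pos_powr_of_pos powr_realpow)
    qed
    then have "(fdiff ^^ D) f 0 = (- 1) ^ D * f 0" by (rule fdiff_pow_supported_at_0)
    \<comment> \<open>\<open>D = k + 2\<close> has the parity of \<open>k\<close>, so the signs of
      \<open>(- 1) ^ D\<close> and \<open>(- real D) ^ k\<close> cancel.\<close>
    also have "\<dots> = - (real D ^ k)" using k by (simp add: f_def D_def power_mult_distrib [symmetric] add.commute)
    finally have "(fdiff ^^ D) f 0 = - (real D ^ k)" .
    moreover have "(fdiff ^^ D) (\<lambda>x. (2 ^ D * x + (- real D)) ^ k) 0 = 0"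
      unfolding D_def numeral_2_eq_2 add_Suc_right add_0_right
      by (subst fdiff_pow_Suc) (simp only: fdiff_pow_power_eq_0 diff_self)
    then have "(fdiff ^^ D) f 0 = (fdiff ^^ D) (\<lambda>x. pos_powr q (2 ^ D * x - real D)) 0"
      unfolding f_def fdiff_pow_add fdiff_pow_cmult by simp
    moreover have "0 < real D ^ k" by (simp add: D_def)
    ultimately have "(fdiff ^^ D) (\<lambda>x. pos_powr q (2 ^ D * x - real D)) 0 < 0" by linarith
    then show ?thesis by (intro exI [of _ D]) (auto simp: D_def)
  next
    case False
    \<comment> \<open>Dividing the argument by \<open>2 ^ a\<close> leaves a shift that tends to 0;
      the positive factor \<open>(2 ^ a) powr q\<close> is restored at the end.\<close>
    have "(\<lambda>a. pos_powr q (x - real D / 2 ^ a)) \<longlonglongrightarrow> pos_powr q x" for x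
    proof -
      have "(\<lambda>a. x - real D / 2 ^ a) \<longlonglongrightarrow> x" by real_asymp
      then show ?thesis by (rule isCont_tendsto_compose [OF isCont_pos_powr, rotated]) (use q in simp)
    qed
    then have "(\<lambda>a. (fdiff ^^ D) (\<lambda>x. pos_powr q (x - real D / 2 ^ a)) 0)
        \<longlonglongrightarrow> (fdiff ^^ D) (pos_powr q) 0"
      by (rule fdiff_pow_tendsto)
    moreover have "(fdiff ^^ D) (pos_powr q) 0 < 0"
      using fdiff_pow_pos_powr_neg [of r 0 k] False r by (simp add: D_def r_def)
    ultimately have "eventually (\<lambda>a. (fdiff ^^ D) (\<lambda>x. pos_powr q (x - real D / 2 ^ a)) 0 < 0) sequentially"
      by (rule order_tendstoD)
    with eventually_gt_at_top [of 0]
    have "eventually (\<lambda>a. 0 < a \<and> (fdiff ^^ D) (\<lambda>x. pos_powr q (x - real D / 2 ^ a)) 0 < 0) sequentially"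
      by (rule eventually_conj)
    then obtain a where a: "0 < a" "(fdiff ^^ D) (\<lambda>x. pos_powr q (x - real D / 2 ^ a)) 0 < 0"
      using eventually_happens' [OF sequentially_bot] by blast
    have "pos_powr q (2 ^ a * x - real D) = (2 ^ a) powr q * pos_powr q (x - real D / 2 ^ a)" for x
      using pos_powr_mult [of "2 ^ a" q "x - real D / 2 ^ a"] by (simp add: right_diff_distrib)
    then have "(fdiff ^^ D) (\<lambda>x. pos_powr q (2 ^ a * x - real D)) 0 < 0"
      using a by (simp add: fdiff_pow_cmult mult_less_0_iff)
    moreover have "2 \<le> D" by (simp add: D_def)
    ultimately show ?thesis using a by blast
  qed
qed

section \<open>Cayley graphs of elementary abelian 2-groups\<close>

text \<open>The characters of the group of subsets of a finite set under symmetric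
  difference.\<close>

definition walsh :: "'a set \<Rightarrow> 'a set \<Rightarrow> real" where
  "walsh S T = (- 1) ^ card (S \<inter> T)"

lemma walsh_commute: "walsh S T = walsh T S"
  by (simp add: walsh_def Int_commute)

lemma walsh_empty [simp]: "walsh S {} = 1"
  by (simp add: walsh_def)

lemma walsh_eq_prod:
  assumes "finite V" "T \<subseteq> V"
  shows "walsh S T = (\<Prod>u\<in>V. if u \<in> S \<inter> T then - 1 else 1)"
proof -
  have "V \<inter> {u. u \<in> S \<inter> T} = S \<inter> T" using assms by auto
  then show ?thesis using assms by (simp add: walsh_def prod.If_cases)
qed

lemma walsh_sym_diff:
  assumes "finite T" "finite T'"
  shows "walsh S (sym_diff T T') = walsh S T * walsh S T'"
proof -
  have "walsh S (sym_diff T T') = (\<Prod>u\<in>T \<union> T'. if u \<in> S \<inter> sym_diff T T' then - 1 else 1)"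
    using assms by (intro walsh_eq_prod) auto
  also have "\<dots> = (\<Prod>u\<in>T \<union> T'. (if u \<in> S \<inter> T then - 1 else 1) * (if u \<in> S \<inter> T' then - 1 else 1))"
    by (intro prod.cong) auto
  also have "\<dots> = walsh S T * walsh S T'"
    unfolding prod.distrib using assms by (simp add: walsh_eq_prod [of "T \<union> T'"])
  finally show ?thesis .
qed

lemma walsh_Un_disjoint:
  assumes "finite T" "finite T'" "T \<inter> T' = {}"
  shows "walsh S (T \<union> T') = walsh S T * walsh S T'"
  using walsh_sym_diff [of T T' S] assms by (simp add: Diff_triv Int_commute)

lemma bij_betw_sym_diff_Pow:
  assumes "T \<subseteq> U" shows "bij_betw (sym_diff T) (Pow U) (Pow U)"
  by (rule bij_betw_byWitness [where f' = "sym_diff T"]) (use assms in auto)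

text \<open>If \<open>u\<close> lies in both \<open>S\<close> and \<open>U\<close>, translation by
  \<open>{u}\<close> permutes \<open>Pow U\<close> and flips the sign of every term, so the sum
  equals its own negative.\<close>

lemma sum_walsh_Pow:
  assumes "finite U"
  shows "(\<Sum>T\<in>Pow U. walsh S T) = (if S \<inter> U = {} then 2 ^ card U else 0)"
proof (cases "S \<inter> U = {}")
  case True
  then have "walsh S T = 1" if "T \<in> Pow U" for T
  proof -
    have "S \<inter> T = {}" using that True by auto
    then show ?thesis by (simp add: walsh_def)
  qed
  with True assms show ?thesis by (simp add: card_Pow)
next
  case False
  then obtain u where u: "u \<in> S" "u \<in> U" by auto
  then have "(\<Sum>T\<in>Pow U. walsh S T) = (\<Sum>T\<in>Pow U. walsh S (sym_diff {u} T))"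
    by (intro sum.reindex_bij_betw [symmetric] bij_betw_sym_diff_Pow) auto
  also have "\<dots> = (\<Sum>T\<in>Pow U. - walsh S T)"
  proof (rule sum.cong [OF refl])
    fix T assume "T \<in> Pow U"
    then have "finite T" using assms finite_subset by auto
    then have "walsh S (sym_diff {u} T) = walsh S {u} * walsh S T" by (intro walsh_sym_diff) auto
    with u show "walsh S (sym_diff {u} T) = - walsh S T" by (simp add: walsh_def)
  qed
  finally show ?thesis using False by (simp add: sum_negf)
qed

lemma walsh_orthogonal:
  assumes "finite U" "S \<subseteq> U" "S' \<subseteq> U"
  shows "(\<Sum>T\<in>Pow U. walsh S T * walsh T S') = (if S = S' then 2 ^ card U else 0)"
proof -
  have "finite S" "finite S'" using assms finite_subset by auto
  then have "walsh S T * walsh T S' = walsh (sym_diff S S') T" for T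
    using walsh_sym_diff [of S S' T] by (simp add: walsh_commute)
  moreover have "sym_diff S S' \<inter> U = {} \<longleftrightarrow> S = S'" using assms by auto
  ultimately show ?thesis using assms by (simp add: sum_walsh_Pow)
qed

text \<open>Vertices are indices, with \<open>h\<close> naming their group elements, because the
  adjacency matrix needs a linear order on the vertices.\<close>

definition cayley_graph :: "(nat \<Rightarrow> 'a set) \<Rightarrow> nat \<Rightarrow> 'a set set \<Rightarrow> nat pair_pre_digraph" where
  "cayley_graph h n C =
    \<lparr>pverts = {..<n}, parcs = {(i, j). i < n \<and> j < n \<and> sym_diff (h i) (h j) \<in> C}\<rparr>"

lemma cayley_graph_simps [simp]:
  "pverts (cayley_graph h n C) = {..<n}"
  "parcs (cayley_graph h n C) = {(i, j). i < n \<and> j < n \<and> sym_diff (h i) (h j) \<in> C}"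
  by (auto simp: cayley_graph_def)

lemma pair_graph_cayley_graph:
  assumes "{} \<notin> C" shows "pair_graph (cayley_graph h n C)"
proof
  show "finite (parcs (cayley_graph h n C))"
    by (rule finite_subset [of _ "{..<n} \<times> {..<n}"]) auto
  show "symmetric (with_proj (cayley_graph h n C))"
    by (auto simp: symmetric_def sym_def Un_commute)
qed (use assms in auto)

lemma adj_eigenvalues_diagonalizable:
  assumes PQ: "P \<in> carrier_mat n n" "Q \<in> carrier_mat n n" "P * Q = 1\<^sub>m n" "Q * P = 1\<^sub>m n"
    and n: "card (pverts G) = n"
    and eq: "adj_matrix G * P = P * mat n n (\<lambda>(i, j). if i = j then d i else 0)"
  shows "adj_eigenvalues G = mset (map d [0..<n])"
proof -
  define A where "A = adj_matrix G"
  define E where "E = mat n n (\<lambda>(i, j). if i = j then d i else 0)"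
  have A: "A \<in> carrier_mat n n" using adj_matrix_carrier [of G] n by (simp add: A_def)
  have E: "E \<in> carrier_mat n n" by (simp add: E_def)
  have "A = A * (P * Q)" using A PQ by simp
  also have "\<dots> = A * P * Q" using A PQ by simp
  also have "\<dots> = P * E * Q" using eq by (simp add: A_def E_def)
  finally have "similar_mat A E"
    using A E PQ by (intro similar_matI [of _ _ P Q n]) auto
  then have "char_poly A = char_poly E" by (rule char_poly_similar)
  also have "\<dots> = (\<Prod>a\<leftarrow>diag_mat E. [:- a, 1:])"
    by (rule char_poly_upper_triangular [OF E]) (auto simp: upper_triangular_def E_def)
  also have "diag_mat E = map d [0..<n]" by (auto simp: diag_mat_def E_def)
  finally have "char_poly A = (\<Prod>a\<leftarrow>map d [0..<n]. [:- a, 1:])" .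
  moreover have "proots (\<Prod>a\<leftarrow>xs. [:- a, 1:]) = mset xs" for xs :: "real list"
  proof (induction xs)
    case (Cons x xs)
    have "(\<Prod>a\<leftarrow>xs. [:- a, 1:]) \<noteq> 0" by (auto simp: prod_list_zero_iff)
    with Cons show ?case by (simp add: proots_mult del: mult_pCons_left)
  qed simp
  ultimately have "proots (char_poly A) = mset (map d [0..<n])" by (simp only:)
  then show ?thesis by (simp add: adj_eigenvalues_def A_def)
qed

lemma sum_filter_mset_pos_powr:
  "(\<Sum>l\<in>#filter_mset (\<lambda>l. 0 < l) (mset xs). l powr p) = (\<Sum>l\<leftarrow>xs. pos_powr p l)"
  by (induction xs) (auto simp: pos_powr_of_pos)

text \<open>The Walsh functions are common eigenvectors of all translations, so the eigenvalue at
  \<open>S\<close> is the sum of this character over the connection set.\<close>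

lemma positive_energy_cayley_graph:
  assumes U: "finite U" and n: "n = 2 ^ card U" and h: "bij_betw h {..<n} (Pow U)"
    and C: "C \<subseteq> Pow U"
  shows "positive_energy p (cayley_graph h n C) = (\<Sum>S\<in>Pow U. pos_powr p (\<Sum>T\<in>C. walsh S T))"
proof -
  define A where "A = adj_matrix (cayley_graph h n C)"
  define d where "d i = (\<Sum>T\<in>C. walsh (h i) T)" for i
  define P where "P = mat n n (\<lambda>(i, j). walsh (h i) (h j))"
  define E where "E = mat n n (\<lambda>(i, j). if i = j then d i else 0)"
  have P: "P \<in> carrier_mat n n" and E: "E \<in> carrier_mat n n" by (auto simp: P_def E_def)
  have A_eq: "A = mat n n (\<lambda>(i, j). if sym_diff (h i) (h j) \<in> C then 1 else 0)"
    unfolding A_def adj_matrix_def by (auto simp: Let_def lessThan_atLeast0)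
  have n0: "0 < n" using n by simp
  have hU: "h i \<subseteq> U" if "i < n" for i using h that by (auto simp: bij_betw_def)
  have inj: "h i = h j \<longleftrightarrow> i = j" if "i < n" "j < n" for i j
    using h that by (auto simp: bij_betw_def inj_on_def)
  have sum_h: "(\<Sum>k = 0..<n. f (h k)) = (\<Sum>T\<in>Pow U. f T)" for f :: "'a set \<Rightarrow> real"
    using sum.reindex_bij_betw [OF h, of f] by (simp add: lessThan_atLeast0)
  \<comment> \<open>Orthogonality makes the Walsh matrix its own inverse up to the factor
    \<open>n\<close>.\<close>
  have PP: "P * P = real n \<cdot>\<^sub>m 1\<^sub>m n"
  proof (rule eq_matI)
    fix i j assume "i < dim_row (real n \<cdot>\<^sub>m 1\<^sub>m n)" "j < dim_col (real n \<cdot>\<^sub>m 1\<^sub>m n)"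
    then have ij: "i < n" "j < n" by auto
    then have "(P * P) $$ (i, j) = (\<Sum>k = 0..<n. walsh (h i) (h k) * walsh (h k) (h j))"
      by (simp add: P_def scalar_prod_def)
    also have "\<dots> = (\<Sum>T\<in>Pow U. walsh (h i) T * walsh T (h j))" by (rule sum_h)
    also have "\<dots> = (if i = j then real n else 0)"
      using ij hU inj U n by (simp add: walsh_orthogonal)
    finally show "(P * P) $$ (i, j) = (real n \<cdot>\<^sub>m 1\<^sub>m n) $$ (i, j)" using ij by simp
  qed (simp_all add: P_def)
  have AP: "A * P = P * E"
  proof (rule eq_matI)
    fix i j assume "i < dim_row (P * E)" "j < dim_col (P * E)"
    then have ij: "i < n" "j < n" by (auto simp: P_def E_def)
    have fin: "finite T" if "T \<subseteq> U" for T using U that finite_subset by auto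
    have "(A * P) $$ (i, j) = (\<Sum>k = 0..<n. (if sym_diff (h i) (h k) \<in> C then 1 else 0) * walsh (h k) (h j))"
      using ij by (simp add: P_def A_eq scalar_prod_def)
    also have "\<dots> = (\<Sum>T\<in>Pow U. (if sym_diff (h i) T \<in> C then 1 else 0) * walsh T (h j))"
      by (rule sum_h [of "\<lambda>T. (if sym_diff (h i) T \<in> C then 1 else 0) * walsh T (h j)"])
    \<comment> \<open>The substitution centres the sum at the vertex \<open>i\<close>, after which
      the character splits off the factor \<open>walsh (h i) (h j)\<close>.\<close>
    also have "\<dots> = (\<Sum>T\<in>Pow U. (if sym_diff (h i) (sym_diff (h i) T) \<in> C then 1 else 0) * walsh (sym_diff (h i) T) (h j))"
      using ij hU by (intro sum.reindex_bij_betw [symmetric] bij_betw_sym_diff_Pow) auto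
    also have "\<dots> = (\<Sum>T\<in>Pow U. if T \<in> C then walsh (h i) (h j) * walsh (h j) T else 0)"
    proof (rule sum.cong [OF refl])
      fix T assume "T \<in> Pow U"
      then have "walsh (sym_diff (h i) T) (h j) = walsh (h i) (h j) * walsh (h j) T"
        using fin hU ij by (subst (1 2) walsh_commute) (simp add: walsh_sym_diff)
      moreover have "sym_diff (h i) (sym_diff (h i) T) = T" by auto
      ultimately show "(if sym_diff (h i) (sym_diff (h i) T) \<in> C then 1 else 0) * walsh (sym_diff (h i) T) (h j)
          = (if T \<in> C then walsh (h i) (h j) * walsh (h j) T else 0)" by simp
    qed
    also have "\<dots> = walsh (h i) (h j) * d j"
      using U C by (simp add: d_def sum_distrib_left flip: sum.inter_filter) (intro sum.cong, auto)
    also have "\<dots> = (P * E) $$ (i, j)"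
      using ij by (simp add: P_def E_def scalar_prod_def if_distrib [of "(*) _"] sum.delta cong: if_cong)
    finally show "(A * P) $$ (i, j) = (P * E) $$ (i, j)" .
  qed (auto simp: A_eq P_def E_def)
  define Q where "Q = (1 / real n) \<cdot>\<^sub>m P"
  have "P * Q = 1\<^sub>m n" "Q * P = 1\<^sub>m n" "Q \<in> carrier_mat n n"
    using P n0 by (auto simp: Q_def PP mult_smult_distrib [of _ n n _ n] mult_smult_assoc_mat [of _ n n _ n])
  then have "adj_eigenvalues (cayley_graph h n C) = mset (map d [0..<n])"
    using adj_eigenvalues_diagonalizable [of P n Q "cayley_graph h n C" d] P AP by (simp add: A_def E_def)
  then have "positive_energy p (cayley_graph h n C) = (\<Sum>i = 0..<n. pos_powr p (d i))"
    unfolding positive_energy_def sum_filter_mset_pos_powr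
    by (simp add: sum_filter_mset_pos_powr comp_def interv_sum_list_conv_sum_set_nat del: mset_map)
  also have "\<dots> = (\<Sum>S\<in>Pow U. pos_powr p (\<Sum>T\<in>C. walsh S T))"
    unfolding d_def by (rule sum_h)
  finally show ?thesis .
qed

section \<open>From two nested graphs to a single edge\<close>

lemma ex_energy_decreasing_edge:
  assumes "pair_graph G" "pair_graph G'" "pverts G = pverts G'" "parcs G \<subseteq> parcs G'"
    and "positive_energy p G' < positive_energy p G"
  shows "\<exists>H. pair_graph H \<and> pverts H = pverts G \<and> parcs G \<subseteq> parcs H \<and>
    (\<exists>u\<in>pverts H. \<exists>v\<in>pverts H. u \<noteq> v \<and> (u, v) \<notin> parcs H \<and>
      positive_energy p (add_edge H u v) < positive_energy p H)"
  using assms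
proof (induction "card (parcs G' - parcs G)" arbitrary: G rule: less_induct)
  case less
  interpret G: pair_graph G by fact
  interpret G': pair_graph G' by fact
  have "parcs G \<noteq> parcs G'"
    using less.prems by (cases G, cases G') auto
  then obtain u v where uv: "(u, v) \<in> parcs G'" "(u, v) \<notin> parcs G" using less.prems by auto
  then have uv': "u \<in> pverts G" "v \<in> pverts G" "u \<noteq> v"
    using G'.wellformed' G'.pair_no_loops less.prems by fastforce+
  have vu: "(v, u) \<in> parcs G'"
    using G'.pair_sym_arcs uv by (auto simp: symmetric_def sym_def)
  show ?case
  proof (cases "positive_energy p (add_edge G u v) < positive_energy p G")
    case True
    with uv uv' less.prems show ?thesis by blast
  next
    case False
    \<comment> \<open>The enlarged graph is still contained in \<open>G'\<close>, has fewer missing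
      arcs, and by \<open>False\<close> still has more energy than \<open>G'\<close>.\<close>
    have "card (parcs G' - parcs (add_edge G u v)) < card (parcs G' - parcs G)"
      using uv by (intro psubset_card_mono) (auto simp: add_edge_def)
    moreover have "pair_graph (add_edge G u v)" using uv' by (rule G.pair_graph_add_edge)
    ultimately have "\<exists>H. pair_graph H \<and> pverts H = pverts (add_edge G u v) \<and>
      parcs (add_edge G u v) \<subseteq> parcs H \<and>
      (\<exists>u\<in>pverts H. \<exists>v\<in>pverts H. u \<noteq> v \<and> (u, v) \<notin> parcs H \<and>
        positive_energy p (add_edge H u v) < positive_energy p H)"
      using less.prems uv vu False by (intro less.hyps) (auto simp: add_edge_def)
    then show ?thesis by (auto simp: add_edge_def)
  qed
qed

section \<open>Connectedness\<close>

lemma connected_supergraph: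
  assumes "pair_graph G" "pair_graph H" "pverts H = pverts G" "parcs G \<subseteq> parcs H"
    and "Digraph_Component.connected (with_proj G)"
  shows "Digraph_Component.connected (with_proj H)"
proof -
  interpret G: pair_graph G by fact
  interpret H: pair_graph H by fact
  have "(parcs G)\<^sup>s \<subseteq> (parcs H)\<^sup>s" using assms by (auto simp: symcl_def)
  then show ?thesis
    using assms rtrancl_on_mono [of "(parcs G)\<^sup>s" "(parcs H)\<^sup>s" "pverts G" "pverts H"]
    by (auto simp: connected_conv)
qed

text \<open>By \<open>gen\<close>, each singleton is a product of at most two generators. A set is
  thus reached from \<open>{}\<close> by inserting its elements one at a time, each along one or two
  edges.\<close>

lemma connected_cayley_graph:
  assumes U: "finite U" and h: "bij_betw h {..<n} (Pow U)" and C: "{} \<notin> C" "C \<subseteq> Pow U"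
    and gen: "\<And>u. u \<in> U \<Longrightarrow> {u} \<in> C \<or> (\<exists>T\<in>C. sym_diff T {u} \<in> C)"
  shows "Digraph_Component.connected (with_proj (cayley_graph h n C))"
proof -
  let ?G = "cayley_graph h n C"
  interpret pair_graph ?G using C by (intro pair_graph_cayley_graph)
  have ex: "\<exists>i<n. h i = T" if "T \<subseteq> U" for T
  proof -
    have "T \<in> h ` {..<n}" using h that by (auto simp: bij_betw_def)
    then show ?thesis by auto
  qed
  obtain o' where o': "o' < n" "h o' = {}" using ex [of "{}"] by auto
  have inj: "i = j" if "i < n" "j < n" "h i = h j" for i j
    using h that by (auto simp: bij_betw_def inj_on_def)
  have adj: "i \<rightarrow>\<^sup>*\<^bsub>?G\<^esub> j" if "i < n" "j < n" "sym_diff (h i) (h j) \<in> C" for i j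
    using that by (intro reachable_adjI) auto
  have reach: "o' \<rightarrow>\<^sup>*\<^bsub>?G\<^esub> j" if "finite T" "T \<subseteq> U" "j < n" "h j = T" for T j
    using that
  proof (induction T arbitrary: j)
    case empty
    then have "j = o'" using o' inj by simp
    then show ?case using o' by (simp add: reachable_refl)
  next
    case (insert u T)
    obtain i where i: "i < n" "h i = T" using ex [of T] insert.prems by auto
    then have "o' \<rightarrow>\<^sup>*\<^bsub>?G\<^esub> i" using insert by auto
    moreover have "u \<in> U" using insert.prems by auto
    from gen [OF this] have "i \<rightarrow>\<^sup>*\<^bsub>?G\<^esub> j"
    proof (elim disjE bexE)
      assume "{u} \<in> C"
      moreover have "sym_diff (h i) (h j) = {u}" using insert i by auto
      ultimately show ?thesis using insert i by (intro adj) auto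
    next
      fix S assume S: "S \<in> C" "sym_diff S {u} \<in> C"
      then obtain k where k: "k < n" "h k = sym_diff T S"
        using ex [of "sym_diff T S"] C insert.prems by auto
      have "sym_diff (h i) (h k) = S" using i k by auto
      then have "i \<rightarrow>\<^sup>*\<^bsub>?G\<^esub> k" using S i k by (intro adj) auto
      moreover have "sym_diff (h k) (h j) = sym_diff S {u}" using insert k by auto
      then have "k \<rightarrow>\<^sup>*\<^bsub>?G\<^esub> j" using S insert k by (intro adj) auto
      ultimately show ?thesis by (rule reachable_trans)
    qed
    ultimately show ?case by (metis reachable_trans)
  qed
  have reach': "o' \<rightarrow>\<^sup>*\<^bsub>?G\<^esub> j" if "j < n" for j
  proof (rule reach)
    show "h j \<subseteq> U" using h that by (auto simp: bij_betw_def)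
    then show "finite (h j)" using U finite_subset by auto
  qed (use that in auto)
  have "(i, j) \<in> rtrancl_on {..<n} ((parcs ?G)\<^sup>s)" if "i < n" "j < n" for i j
  proof -
    from that have "i \<rightarrow>\<^sup>*\<^bsub>?G\<^esub> o'" "o' \<rightarrow>\<^sup>*\<^bsub>?G\<^esub> j"
      using reach' [of i] reach' [of j] symmetric_reachable [OF pair_sym_arcs] by auto
    then have "i \<rightarrow>\<^sup>*\<^bsub>?G\<^esub> j" by (rule reachable_trans)
    then have "(i, j) \<in> rtrancl_on {..<n} (parcs ?G)" by (simp add: reachable_def)
    then show ?thesis by (rule rtrancl_on_mono [rotated 2]) (auto simp: symcl_def)
  qed
  then show ?thesis using o' by (auto simp: connected_conv)
qed

section \<open>Blown-up Hamming graphs\<close>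

lemma sum_Pow_Un_disjoint:
  assumes "A \<inter> B = {}"
  shows "(\<Sum>S\<in>Pow (A \<union> B). f S) = (\<Sum>S\<in>Pow A. \<Sum>R\<in>Pow B. f (S \<union> R))"
proof -
  have "bij_betw (\<lambda>(S, R). S \<union> R) (Pow A \<times> Pow B) (Pow (A \<union> B))"
    by (rule bij_betw_byWitness [where f' = "\<lambda>S. (S \<inter> A, S \<inter> B)"]) (use assms in auto)
  from sum.reindex_bij_betw [OF this, of f] show ?thesis
    by (simp add: sum.cartesian_product case_prod_unfold)
qed

text \<open>
  The group is the power set of \<open>cube D a \<union> block n D\<close> under symmetric difference: \<open>block a i\<close> with
  \<open>i < D\<close> carries the \<open>i\<close>-th coordinate of the Hamming graph \<open>H(D, 2\<^sup>a)\<close>, and \<open>block n D\<close> numbers the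
  \<open>2\<^sup>n\<close> copies of each vertex. The translation \<open>t\<close> is \<open>transversal D\<close>.
\<close>

definition block :: "nat \<Rightarrow> nat \<Rightarrow> (nat \<times> nat) set" where
  "block a i = {i} \<times> {..<a}"

definition cube :: "nat \<Rightarrow> nat \<Rightarrow> (nat \<times> nat) set" where
  "cube D a = {..<D} \<times> {..<a}"

text \<open>The number of coordinates on which the character \<open>S\<close> is trivial. For
  \<open>S \<subseteq> cube D a\<close> it determines the eigenvalue of the Hamming graph,
  \<open>2 ^ a * avoided D a S - real D\<close>.\<close>

definition avoided :: "nat \<Rightarrow> nat \<Rightarrow> (nat \<times> nat) set \<Rightarrow> real" where
  "avoided D a S = real (card {i. i < D \<and> S \<inter> block a i = {}})"

definition transversal :: "nat \<Rightarrow> (nat \<times> nat) set" where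
  "transversal D = {..<D} \<times> {0}"

text \<open>\<open>T\<close> changes exactly one Hamming coordinate. Since \<open>R\<close> is
  arbitrary, copies of adjacent vertices are completely joined; since \<open>T\<close> is nonempty,
  copies of one vertex stay independent.\<close>

definition hamming_set :: "nat \<Rightarrow> nat \<Rightarrow> nat \<Rightarrow> (nat \<times> nat) set set" where
  "hamming_set D a n = (\<lambda>(T, R). T \<union> R) ` ((\<Union>i<D. Pow (block a i) - {{}}) \<times> Pow (block n D))"

lemma finite_block [simp]: "finite (block a i)"
  by (simp add: block_def)

lemma finite_cube [simp]: "finite (cube D a)"
  by (simp add: cube_def)

lemma avoided_Suc:
  assumes "S \<subseteq> cube D a" "R \<subseteq> block a D"
  shows "avoided (Suc D) a (S \<union> R) = avoided D a S + (if R = {} then 1 else 0)"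
proof -
  have "{i. i < Suc D \<and> (S \<union> R) \<inter> block a i = {}}
      = {i. i < D \<and> S \<inter> block a i = {}} \<union> (if R = {} then {D} else {})"
    using assms by (auto simp: block_def cube_def less_Suc_eq)
  then show ?thesis by (simp add: avoided_def)
qed

text \<open>Each block performs one forward difference. In the last block, \<open>R = {}\<close> has
  weight 1 and raises the count by 1, while the other \<open>R\<close> have total weight -1, because
  \<open>(D, 0)\<close> lies in the block and so all weights sum to 0. Summing over \<open>R\<close>
  replaces \<open>g\<close> by \<open>fdiff g\<close>.\<close>

lemma sum_walsh_transversal:
  assumes "0 < a"
  shows "(\<Sum>S\<in>Pow (cube D a). walsh S (transversal D) * g (avoided D a S)) = (fdiff ^^ D) g 0"
proof (induction D arbitrary: g)
  case 0
  then show ?case by (simp add: cube_def transversal_def avoided_def)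
next
  case (Suc D)
  have disj: "cube D a \<inter> block a D = {}" by (auto simp: cube_def block_def)
  have "cube (Suc D) a = cube D a \<union> block a D" by (auto simp: cube_def block_def less_Suc_eq)
  then have "(\<Sum>S\<in>Pow (cube (Suc D) a). walsh S (transversal (Suc D)) * g (avoided (Suc D) a S))
      = (\<Sum>S\<in>Pow (cube D a). \<Sum>R\<in>Pow (block a D).
          walsh (S \<union> R) (transversal (Suc D)) * g (avoided (Suc D) a (S \<union> R)))"
    using sum_Pow_Un_disjoint [OF disj] by simp
  also have "\<dots> = (\<Sum>S\<in>Pow (cube D a). walsh S (transversal D) * fdiff g (avoided D a S))"
  proof (rule sum.cong [OF refl])
    fix S assume "S \<in> Pow (cube D a)"
    then have S: "S \<subseteq> cube D a" by auto
    have "(\<Sum>R\<in>Pow (block a D). walsh (S \<union> R) (transversal (Suc D)) * g (avoided (Suc D) a (S \<union> R)))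
        = (\<Sum>R\<in>Pow (block a D). walsh S (transversal D) *
            (walsh {(D, 0)} R * g (avoided D a S) + (if R = {} then fdiff g (avoided D a S) else 0)))"
    proof (rule sum.cong [OF refl])
      fix R assume "R \<in> Pow (block a D)"
      then have R: "R \<subseteq> block a D" by auto
      have "transversal (Suc D) = transversal D \<union> {(D, 0)}"
        by (auto simp: transversal_def less_Suc_eq)
      then have "walsh (S \<union> R) (transversal (Suc D)) = walsh (S \<union> R) (transversal D) * walsh (S \<union> R) {(D, 0)}"
        by (simp only:) (intro walsh_Un_disjoint, auto simp: transversal_def)
      moreover have "(S \<union> R) \<inter> transversal D = S \<inter> transversal D" "(S \<union> R) \<inter> {(D, 0)} = R \<inter> {(D, 0)}"
        using S R by (auto simp: transversal_def cube_def block_def)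
      ultimately have "walsh (S \<union> R) (transversal (Suc D)) = walsh S (transversal D) * walsh {(D, 0)} R"
        by (simp add: walsh_def Int_commute)
      then show "walsh (S \<union> R) (transversal (Suc D)) * g (avoided (Suc D) a (S \<union> R))
          = walsh S (transversal D) *
            (walsh {(D, 0)} R * g (avoided D a S) + (if R = {} then fdiff g (avoided D a S) else 0))"
        using S R by (simp add: avoided_Suc fdiff_def)
    qed
    also have "\<dots> = walsh S (transversal D) * ((\<Sum>R\<in>Pow (block a D). walsh {(D, 0)} R) * g (avoided D a S)
        + (\<Sum>R\<in>Pow (block a D). if R = {} then fdiff g (avoided D a S) else 0))"
      by (simp only: sum_distrib_left [symmetric] sum.distrib sum_distrib_right)
    also have "(\<Sum>R\<in>Pow (block a D). walsh {(D, 0)} R) = 0"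
      using assms by (simp add: sum_walsh_Pow block_def)
    also have "(\<Sum>R\<in>Pow (block a D). if R = {} then fdiff g (avoided D a S) else 0) = fdiff g (avoided D a S)"
      by (simp add: sum.delta)
    finally show "(\<Sum>R\<in>Pow (block a D). walsh (S \<union> R) (transversal (Suc D)) * g (avoided (Suc D) a (S \<union> R)))
        = walsh S (transversal D) * fdiff g (avoided D a S)" by simp
  qed
  also have "\<dots> = (fdiff ^^ Suc D) g 0"
    by (simp add: Suc funpow_Suc_right del: funpow.simps)
  finally show ?case .
qed

text \<open>The sum factors over \<open>T\<close> and \<open>R\<close>. Block \<open>i\<close> gives
  \<open>2 ^ a - 1\<close> if \<open>S\<close> misses it and \<open>- 1\<close> otherwise; the sum
  over copies kills every character nontrivial on \<open>block n D\<close>.\<close>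

lemma sum_walsh_hamming_set:
  "(\<Sum>T\<in>hamming_set D a n. walsh S T)
    = (if S \<inter> block n D = {} then 2 ^ n * (2 ^ a * avoided D a S - real D) else 0)"
proof -
  let ?B = "\<Union>i<D. Pow (block a i) - {{}}"
  have sub: "T \<subseteq> cube D a" if "T \<in> ?B" for T using that by (auto simp: block_def cube_def)
  have disj: "cube D a \<inter> block n D = {}" by (auto simp: cube_def block_def)
  have "inj_on (\<lambda>(T, R). T \<union> R) (?B \<times> Pow (block n D))"
    by (rule inj_on_inverseI [where g = "\<lambda>S. (S \<inter> cube D a, S \<inter> block n D)"])
      (use sub disj in \<open>auto 4 3\<close>)
  then have "(\<Sum>T\<in>hamming_set D a n. walsh S T)
      = (\<Sum>(T, R)\<in>?B \<times> Pow (block n D). walsh S (T \<union> R))"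
    unfolding hamming_set_def by (subst sum.reindex) (auto simp: case_prod_unfold)
  also have "\<dots> = (\<Sum>T\<in>?B. \<Sum>R\<in>Pow (block n D). walsh S T * walsh S R)"
    unfolding sum.cartesian_product
  proof (rule sum.cong [OF refl])
    fix X assume "X \<in> ?B \<times> Pow (block n D)"
    then obtain T R where X: "X = (T, R)" and "T \<in> ?B" and R: "R \<subseteq> block n D" by auto
    then have T: "T \<subseteq> cube D a" using sub by blast
    have "finite T" "finite R" using finite_subset [OF T] finite_subset [OF R] by auto
    then have "walsh S (T \<union> R) = walsh S T * walsh S R"
      using T R disj by (intro walsh_Un_disjoint) auto
    then show "(case X of (T, R) \<Rightarrow> walsh S (T \<union> R)) = (case X of (T, R) \<Rightarrow> walsh S T * walsh S R)"
      by (simp add: X)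
  qed
  also have "\<dots> = (\<Sum>T\<in>?B. walsh S T) * (\<Sum>R\<in>Pow (block n D). walsh S R)"
    by (simp add: sum_product)
  also have "(\<Sum>T\<in>?B. walsh S T) = (\<Sum>i<D. \<Sum>T\<in>Pow (block a i) - {{}}. walsh S T)"
    by (rule sum.UNION_disjoint) (auto simp: block_def)
  also have "\<dots> = (\<Sum>i<D. (if S \<inter> block a i = {} then 2 ^ a else 0) - 1)"
  proof (rule sum.cong [OF refl])
    fix i
    show "(\<Sum>T\<in>Pow (block a i) - {{}}. walsh S T) = (if S \<inter> block a i = {} then 2 ^ a else 0) - 1"
      using sum_walsh_Pow [of "block a i" S]
      by (simp add: sum_diff1 card_cartesian_product block_def)
  qed
  also have "\<dots> = 2 ^ a * avoided D a S - real D"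
    by (simp add: sum_subtractf avoided_def sum.If_cases Int_def)
  also have "(\<Sum>R\<in>Pow (block n D). walsh S R) = (if S \<inter> block n D = {} then 2 ^ n else 0)"
    using sum_walsh_Pow [of "block n D" S] by (simp add: block_def card_cartesian_product)
  finally show ?thesis by simp
qed

lemma hamming_set_subset: "hamming_set D a n \<subseteq> Pow (cube D a \<union> block n D)"
  by (auto simp: hamming_set_def block_def cube_def)

lemma connected_hamming_graph:
  assumes "0 < D" "0 < a" "bij_betw h {..<N} (Pow (cube D a \<union> block n D))"
  shows "Digraph_Component.connected (with_proj (cayley_graph h N (hamming_set D a n)))"
proof (rule connected_cayley_graph [OF _ assms(3)])
  show "{} \<notin> hamming_set D a n" by (auto simp: hamming_set_def)
  show "hamming_set D a n \<subseteq> Pow (cube D a \<union> block n D)" by (rule hamming_set_subset)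
  fix u assume u: "u \<in> cube D a \<union> block n D"
  have mem: "T \<union> R \<in> hamming_set D a n"
    if "i < D" "T \<subseteq> block a i" "T \<noteq> {}" "R \<subseteq> block n D" for i T R
    using that by (auto simp: hamming_set_def)
  show "{u} \<in> hamming_set D a n \<or> (\<exists>T\<in>hamming_set D a n. sym_diff T {u} \<in> hamming_set D a n)"
  proof (cases "u \<in> cube D a")
    case True
    then show ?thesis using mem [of "fst u" "{u}" "{}"] by (auto simp: cube_def block_def)
  next
    case False
    with u have u': "u \<in> block n D" by auto
    \<comment> \<open>Here \<open>{u}\<close> is not a generator, but it is the difference of two
      generators sharing \<open>(0, 0)\<close>.\<close>
    have "{(0, 0)} \<union> {} \<in> hamming_set D a n" "{(0, 0)} \<union> {u} \<in> hamming_set D a n"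
      using assms u' by (intro mem [of 0]; auto simp: block_def)+
    moreover have "sym_diff {(0, 0)} {u} = {(0, 0)} \<union> {u}"
      using u' assms by (auto simp: block_def)
    ultimately show ?thesis by (metis sup_bot_right)
  qed
qed simp

text \<open>The translation moves at least two Hamming coordinates, a generator only one. Hence the
  matching consists of new edges.\<close>

lemma transversal_notin_hamming_set:
  assumes "2 \<le> D" shows "transversal D \<notin> hamming_set D a n"
proof
  assume "transversal D \<in> hamming_set D a n"
  then obtain i T R where i: "i < D" and TR: "T \<subseteq> block a i" "R \<subseteq> block n D" "transversal D = T \<union> R"
    by (auto simp: hamming_set_def)
  define j where "j = (if i = 0 then 1 else 0 :: nat)"
  have "(j, 0) \<in> transversal D" "j \<noteq> i" "j < D" using assms by (auto simp: j_def transversal_def)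
  with TR show False by (auto simp: block_def)
qed

lemma card_cube_Un_block: "card (cube D a \<union> block n D) = D * a + n"
proof -
  have "cube D a \<inter> block n D = {}" by (auto simp: cube_def block_def)
  then have "card (cube D a \<union> block n D) = card (cube D a) + card (block n D)"
    by (intro card_Un_disjoint) auto
  then show ?thesis by (simp add: cube_def block_def card_cartesian_product)
qed

lemma sum_walsh_Un_hamming_set:
  assumes "S \<subseteq> cube D a" "R \<subseteq> block n D"
  shows "(\<Sum>T\<in>hamming_set D a n. walsh (S \<union> R) T)
    = (if R = {} then 2 ^ n * (2 ^ a * avoided D a S - real D) else 0)"
proof -
  have "(S \<union> R) \<inter> block n D = R" using assms by (auto simp: cube_def block_def)
  moreover have "(S \<union> R) \<inter> block a i = S \<inter> block a i" if "i < D" for i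
    using that assms by (auto simp: block_def)
  then have "avoided D a (S \<union> R) = avoided D a S"
    unfolding avoided_def by (metis (mono_tags, lifting))
  ultimately show ?thesis by (simp add: sum_walsh_hamming_set)
qed

section \<open>Energies before and after adding the matching\<close>

lemma energy_cayley_graph_cube:
  assumes h: "bij_betw h {..<2 ^ (D * a + n)} (Pow (cube D a \<union> block n D))"
    and C: "C \<subseteq> Pow (cube D a \<union> block n D)"
  shows "positive_energy p (cayley_graph h (2 ^ (D * a + n)) C)
    = (\<Sum>S\<in>Pow (cube D a). \<Sum>R\<in>Pow (block n D). pos_powr p (\<Sum>T\<in>C. walsh (S \<union> R) T))"
proof -
  have "cube D a \<inter> block n D = {}" by (auto simp: cube_def block_def)
  then show ?thesis
    using positive_energy_cayley_graph [OF _ _ h C] by (simp add: card_cube_Un_block sum_Pow_Un_disjoint)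
qed

lemma energy_hamming_graph:
  assumes h: "bij_betw h {..<2 ^ (D * a + n)} (Pow (cube D a \<union> block n D))"
  shows "positive_energy p (cayley_graph h (2 ^ (D * a + n)) (hamming_set D a n))
    = (\<Sum>S\<in>Pow (cube D a). pos_powr p (2 ^ n * (2 ^ a * avoided D a S - real D)))"
  unfolding energy_cayley_graph_cube [OF h hamming_set_subset]
proof (rule sum.cong [OF refl])
  fix S assume "S \<in> Pow (cube D a)"
  then have "(\<Sum>R\<in>Pow (block n D). pos_powr p (\<Sum>T\<in>hamming_set D a n. walsh (S \<union> R) T))
      = (\<Sum>R\<in>Pow (block n D). if R = {} then pos_powr p (2 ^ n * (2 ^ a * avoided D a S - real D)) else 0)"
    by (intro sum.cong refl) (auto simp: sum_walsh_Un_hamming_set)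
  then show "(\<Sum>R\<in>Pow (block n D). pos_powr p (\<Sum>T\<in>hamming_set D a n. walsh (S \<union> R) T))
      = pos_powr p (2 ^ n * (2 ^ a * avoided D a S - real D))" by simp
qed

lemma pos_powr_walsh_le: "pos_powr p (walsh S T) \<le> 1"
  by (cases "even (card (S \<inter> T))") (auto simp: walsh_def pos_powr_of_pos)

text \<open>For nonempty \<open>R\<close> the eigenvalue is now \<open>1\<close> or
  \<open>-1\<close>, contributing at most 1. Allowing 1 for every \<open>R\<close>, the empty set
  included, gives the summand \<open>2 ^ n\<close>.\<close>

lemma energy_hamming_graph_insert_le:
  assumes h: "bij_betw h {..<2 ^ (D * a + n)} (Pow (cube D a \<union> block n D))" and "2 \<le> D" "0 < a"
  shows "positive_energy p (cayley_graph h (2 ^ (D * a + n)) (insert (transversal D) (hamming_set D a n)))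
    \<le> (\<Sum>S\<in>Pow (cube D a). pos_powr p
          (2 ^ n * (2 ^ a * avoided D a S - real D) + walsh S (transversal D)) + 2 ^ n)"
proof -
  have "insert (transversal D) (hamming_set D a n) \<subseteq> Pow (cube D a \<union> block n D)"
    using hamming_set_subset \<open>0 < a\<close> by (auto simp: transversal_def cube_def)
  note energy_cayley_graph_cube [OF h this, of p]
  also have "(\<Sum>S\<in>Pow (cube D a). \<Sum>R\<in>Pow (block n D).
        pos_powr p (\<Sum>T\<in>insert (transversal D) (hamming_set D a n). walsh (S \<union> R) T))
    \<le> (\<Sum>S\<in>Pow (cube D a). \<Sum>R\<in>Pow (block n D). (if R = {} then pos_powr p
          (2 ^ n * (2 ^ a * avoided D a S - real D) + walsh S (transversal D)) else 0) + 1)"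
  proof (intro sum_mono)
    fix S R assume "S \<in> Pow (cube D a)" "R \<in> Pow (block n D)"
    moreover have "finite (hamming_set D a n)"
      by (rule finite_subset [OF hamming_set_subset]) simp
    ultimately have "(\<Sum>T\<in>insert (transversal D) (hamming_set D a n). walsh (S \<union> R) T)
        = walsh (S \<union> R) (transversal D)
          + (if R = {} then 2 ^ n * (2 ^ a * avoided D a S - real D) else 0)"
      using transversal_notin_hamming_set [OF \<open>2 \<le> D\<close>] by (simp add: sum_walsh_Un_hamming_set)
    then show "pos_powr p (\<Sum>T\<in>insert (transversal D) (hamming_set D a n). walsh (S \<union> R) T)
        \<le> (if R = {} then pos_powr p
          (2 ^ n * (2 ^ a * avoided D a S - real D) + walsh S (transversal D)) else 0) + 1"
      using pos_powr_walsh_le [of p "S \<union> R" "transversal D"] by (auto simp: add.commute)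
  qed
  also have "\<dots> = (\<Sum>S\<in>Pow (cube D a). pos_powr p
          (2 ^ n * (2 ^ a * avoided D a S - real D) + walsh S (transversal D)) + 2 ^ n)"
    by (simp add: sum.distrib card_Pow card_cartesian_product block_def)
  finally show ?thesis .
qed

section \<open>The first-order change of the energy\<close>

text \<open>With \<open>M = 2 ^ n\<close> and \<open>x = 1 / M\<close>, the difference of the two
  sides divided by \<open>M powr (p - 1)\<close> is \<open>f x\<close>. Its difference quotients
  tend to derivatives, whose sum is \<open>p\<close> times the sum in \<open>neg\<close>; the
  summand \<open>M\<close> becomes \<open>x powr (p - 2)\<close>, which tends to 0 because
  \<open>p > 2\<close>.\<close>

lemma eventually_sum_pos_powr_less:
  assumes "finite A" and p: "2 < p" and neg: "(\<Sum>s\<in>A. w s * pos_powr (p - 1) (l s)) < 0"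
  shows "eventually (\<lambda>n. (\<Sum>s\<in>A. pos_powr p (2 ^ n * l s + w s) + 2 ^ n)
    < (\<Sum>s\<in>A. pos_powr p (2 ^ n * l s))) sequentially"
proof -
  define f where "f x = (\<Sum>s\<in>A. (pos_powr p (l s + w s * x) - pos_powr p (l s)) / x + x powr (p - 2))" for x
  have "((\<lambda>x. pos_powr p (l s + w s * x)) has_real_derivative (p * pos_powr (p - 1) (l s)) * w s) (at 0)" for s
  proof (rule DERIV_chain2 [where f = "pos_powr p" and g = "\<lambda>x. l s + w s * x"])
    show "(pos_powr p has_real_derivative p * pos_powr (p - 1) (l s)) (at (l s + w s * 0))"
      using DERIV_pos_powr [of p "l s"] p by simp
    show "((\<lambda>x. l s + w s * x) has_real_derivative w s) (at 0)"
      by (auto intro!: derivative_eq_intros)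
  qed
  then have "((\<lambda>x. (pos_powr p (l s + w s * x) - pos_powr p (l s)) / x)
      \<longlongrightarrow> (p * pos_powr (p - 1) (l s)) * w s) (at 0)" for s
    by (simp add: DERIV_def)
  then have "((\<lambda>x. (pos_powr p (l s + w s * x) - pos_powr p (l s)) / x)
      \<longlongrightarrow> (p * pos_powr (p - 1) (l s)) * w s) (at_right 0)" for s
    by (rule filterlim_mono) (auto simp: at_within_le_at)
  moreover have "((\<lambda>x :: real. x powr (p - 2)) \<longlongrightarrow> 0 powr (p - 2)) (at_right 0)"
    using p by (intro tendsto_powr' tendsto_intros) (auto simp: eventually_at_right_less intro: eventually_mono [OF eventually_at_right_less])
  ultimately have "(f \<longlongrightarrow> (\<Sum>s\<in>A. p * pos_powr (p - 1) (l s) * w s + 0 powr (p - 2))) (at_right 0)"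
    unfolding f_def [abs_def] by (intro tendsto_sum tendsto_add)
  also have "(\<Sum>s\<in>A. p * pos_powr (p - 1) (l s) * w s + 0 powr (p - 2))
      = p * (\<Sum>s\<in>A. w s * pos_powr (p - 1) (l s))"
    by (simp add: sum_distrib_left mult_ac)
  finally have "eventually (\<lambda>x. f x < 0) (at_right 0)"
    by (rule order_tendstoD) (use p neg in \<open>simp add: mult_less_0_iff\<close>)
  moreover have "filterlim (\<lambda>n. 1 / 2 ^ n) (at_right (0 :: real)) sequentially"
    by real_asymp
  ultimately have "eventually (\<lambda>n. f (1 / 2 ^ n) < 0) sequentially"
    by (rule eventually_compose_filterlim)
  then show ?thesis
  proof (rule eventually_mono)
    fix n :: nat assume neg: "f (1 / 2 ^ n) < 0"
    define M where "M = (2 :: real) ^ n"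
    have M: "0 < M" by (simp add: M_def)
    have "M powr (p - 1) * ((pos_powr p (l s + w s * (1 / M)) - pos_powr p (l s)) / (1 / M) + (1 / M) powr (p - 2))
        = pos_powr p (M * l s + w s) + M - pos_powr p (M * l s)" for s
    proof -
      have "M * (l s + w s * (1 / M)) = M * l s + w s" using M by (simp add: distrib_left)
      then have 1: "pos_powr p (M * l s + w s) = M powr p * pos_powr p (l s + w s * (1 / M))"
        using pos_powr_mult [OF M, of p "l s + w s * (1 / M)"] by simp
      have 2: "pos_powr p (M * l s) = M powr p * pos_powr p (l s)"
        using M by (rule pos_powr_mult)
      have 3: "M powr (p - 1) * (x / (1 / M)) = M powr p * x" for x
        using M by (simp add: powr_diff)
      have "M powr (p - 1) * (1 / M) powr (p - 2) = M powr (p - 1) / M powr (p - 2)"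
        using M by (simp add: powr_divide)
      also have "\<dots> = M" using M by (simp flip: powr_diff)
      finally show ?thesis unfolding distrib_left 3 1 2 by (simp add: right_diff_distrib)
    qed
    then have "M powr (p - 1) * f (1 / M)
        = (\<Sum>s\<in>A. pos_powr p (M * l s + w s) + M) - (\<Sum>s\<in>A. pos_powr p (M * l s))"
      unfolding f_def sum_distrib_left sum_subtractf [symmetric] by simp
    moreover have "M powr (p - 1) * f (1 / M) < 0"
      using neg M by (simp add: M_def mult_less_0_iff)
    ultimately show "(\<Sum>s\<in>A. pos_powr p (2 ^ n * l s + w s) + 2 ^ n)
      < (\<Sum>s\<in>A. pos_powr p (2 ^ n * l s))" by (simp add: M_def)
  qed
qed

text \<open>The order \<open>2 ^ (k + n)\<close> is recorded so that different \<open>n\<close>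
  yield nonisomorphic graphs.\<close>

lemma ex_connected_energy_decreasing_edge:
  assumes "2 < p"
  shows "\<exists>k. eventually (\<lambda>n. \<exists>G :: nat pair_pre_digraph. pair_graph G \<and>
    Digraph_Component.connected (with_proj G) \<and> card (pverts G) = 2 ^ (k + n) \<and>
    (\<exists>u\<in>pverts G. \<exists>v\<in>pverts G. u \<noteq> v \<and> (u, v) \<notin> parcs G \<and>
      positive_energy p (add_edge G u v) < positive_energy p G)) sequentially"
proof -
  have "1 < p - 1" using assms by simp
  then obtain D a where D: "2 \<le> D" and a: "0 < a"
    and neg: "(fdiff ^^ D) (\<lambda>x. pos_powr (p - 1) (2 ^ a * x - real D)) 0 < 0"
    using ex_fdiff_pos_powr_neg by blast
  \<comment> \<open>Up to the factor \<open>p\<close>, this sum is the first-order coefficient of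
    the energy change.\<close>
  from neg have "(\<Sum>S\<in>Pow (cube D a). walsh S (transversal D) *
      pos_powr (p - 1) (2 ^ a * avoided D a S - real D)) < 0"
    using sum_walsh_transversal [OF a, of D "\<lambda>x. pos_powr (p - 1) (2 ^ a * x - real D)"] by simp
  then have "eventually (\<lambda>n. (\<Sum>S\<in>Pow (cube D a). pos_powr p
        (2 ^ n * (2 ^ a * avoided D a S - real D) + walsh S (transversal D)) + 2 ^ n)
      < (\<Sum>S\<in>Pow (cube D a). pos_powr p (2 ^ n * (2 ^ a * avoided D a S - real D)))) sequentially"
    by (intro eventually_sum_pos_powr_less assms) auto
  then have "eventually (\<lambda>n. \<exists>G :: nat pair_pre_digraph. pair_graph G \<and>
    Digraph_Component.connected (with_proj G) \<and> card (pverts G) = 2 ^ (D * a + n) \<and>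
    (\<exists>u\<in>pverts G. \<exists>v\<in>pverts G. u \<noteq> v \<and> (u, v) \<notin> parcs G \<and>
      positive_energy p (add_edge G u v) < positive_energy p G)) sequentially"
  proof (rule eventually_mono)
    fix n
    assume less: "(\<Sum>S\<in>Pow (cube D a). pos_powr p
        (2 ^ n * (2 ^ a * avoided D a S - real D) + walsh S (transversal D)) + 2 ^ n)
      < (\<Sum>S\<in>Pow (cube D a). pos_powr p (2 ^ n * (2 ^ a * avoided D a S - real D)))"
    define N where "N = (2 :: nat) ^ (D * a + n)"
    have "card (Pow (cube D a \<union> block n D)) = N" by (simp add: card_Pow card_cube_Un_block N_def)
    moreover have "finite (Pow (cube D a \<union> block n D))" by simp
    ultimately obtain h where h: "bij_betw h {..<N} (Pow (cube D a \<union> block n D))"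
      using ex_bij_betw_nat_finite by (metis lessThan_atLeast0)
    define G where "G = cayley_graph h N (hamming_set D a n)"
    define G' where "G' = cayley_graph h N (insert (transversal D) (hamming_set D a n))"
    have "{} \<notin> hamming_set D a n" by (auto simp: hamming_set_def)
    moreover have "transversal D \<noteq> {}" using D by (auto simp: transversal_def lessThan_empty_iff)
    ultimately have G: "pair_graph G" and G': "pair_graph G'"
      by (auto simp: G_def G'_def intro!: pair_graph_cayley_graph)
    have conn: "Digraph_Component.connected (with_proj G)"
      unfolding G_def using D a h by (intro connected_hamming_graph) auto
    have "positive_energy p G' < positive_energy p G"
      using energy_hamming_graph_insert_le [OF h [unfolded N_def] D a, of p]
        energy_hamming_graph [OF h [unfolded N_def], of p] less
      by (simp add: G_def G'_def N_def)
    moreover have "pverts G = pverts G'" "parcs G \<subseteq> parcs G'" by (auto simp: G_def G'_def)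
    ultimately obtain H where "pair_graph H" "pverts H = pverts G" "parcs G \<subseteq> parcs H"
      "\<exists>u\<in>pverts H. \<exists>v\<in>pverts H. u \<noteq> v \<and> (u, v) \<notin> parcs H \<and>
        positive_energy p (add_edge H u v) < positive_energy p H"
      using ex_energy_decreasing_edge [OF G G', of p] by blast
    \<comment> \<open>\<open>H\<close> contains \<open>G\<close> on the same vertices, so it
      inherits both connectedness and the order.\<close>
    moreover from this have "Digraph_Component.connected (with_proj H)"
      using connected_supergraph [OF G _ _ _ conn] by blast
    moreover have "card (pverts G) = 2 ^ (D * a + n)" by (simp add: G_def N_def)
    ultimately show "\<exists>G :: nat pair_pre_digraph. pair_graph G \<and>
      Digraph_Component.connected (with_proj G) \<and> card (pverts G) = 2 ^ (D * a + n) \<and>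
      (\<exists>u\<in>pverts G. \<exists>v\<in>pverts G. u \<noteq> v \<and> (u, v) \<notin> parcs G \<and>
        positive_energy p (add_edge G u v) < positive_energy p G)" by metis
  qed
  then show ?thesis by blast
qed

section \<open>Infinitely many isomorphism classes\<close>

lemma card_pverts_digraph_iso:
  assumes "digraph_iso (with_proj G) (with_proj H)"
  shows "card (pverts G) = card (pverts H)"
proof -
  obtain f where f: "pre_digraph.digraph_isomorphism (with_proj G) f" "with_proj H = app_iso f (with_proj G)"
    using assms by (auto simp: digraph_iso_def)
  then have "pverts H = iso_verts f ` pverts G"
    using verts_app_iso [of f "with_proj G"] by (metis with_proj_simps(1))
  moreover have "inj_on (iso_verts f) (pverts G)"
    using f by (simp add: pre_digraph.digraph_isomorphism_def)
  ultimately show ?thesis by (simp add: card_image)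
qed

theorem theorem1:
  fixes p :: real
  assumes "p > 2"
  shows "\<exists>\<G> :: nat pair_pre_digraph set.
    infinite \<G> \<and>
    pairwise (\<lambda>G H. \<not> digraph_iso (with_proj G) (with_proj H)) \<G> \<and>
    (\<forall>G\<in>\<G>. pair_graph G \<and> Digraph_Component.connected (with_proj G) \<and>
      (\<exists>u\<in>pverts G. \<exists>v\<in>pverts G. u \<noteq> v \<and> (u, v) \<notin> parcs G \<and>
        positive_energy p (add_edge G u v) < positive_energy p G))"
proof -
  let ?P = "\<lambda>G :: nat pair_pre_digraph. pair_graph G \<and> Digraph_Component.connected (with_proj G) \<and>
      (\<exists>u\<in>pverts G. \<exists>v\<in>pverts G. u \<noteq> v \<and> (u, v) \<notin> parcs G \<and>
        positive_energy p (add_edge G u v) < positive_energy p G)"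
  obtain k n0 where "\<forall>n\<ge>n0. \<exists>G. ?P G \<and> card (pverts G) = 2 ^ (k + n)"
    using ex_connected_energy_decreasing_edge [OF assms] unfolding eventually_sequentially by meson
  then obtain F where F: "?P (F n)" "card (pverts (F n)) = 2 ^ (k + n)" if "n0 \<le> n" for n
    by metis
  have inj: "m = n" if "card (pverts (F m)) = card (pverts (F n))" "n0 \<le> m" "n0 \<le> n" for m n
    using that F(2) by simp
  have "infinite (F ` {n0..})"
    using finite_imageD [of F "{n0..}"] inj by (metis atLeast_iff infinite_Ici inj_onI)
  moreover have "pairwise (\<lambda>G H. \<not> digraph_iso (with_proj G) (with_proj H)) (F ` {n0..})"
    by (auto simp: pairwise_def dest!: card_pverts_digraph_iso dest: inj)
  ultimately show ?thesis using F(1) by (intro exI [of _ "F ` {n0..}"]) auto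
qed

end
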